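(* Let $V=\frac{\partial}{\partial x^3}$ and $\eta=dx^3$, and let $\lambda,\mu$ be smooth functions on $I$ with $\mu$ not identically zero. If $f_1=f_1(x^2)$ depends only on $x^2$ and $f_2=f_2(x^1)$ depends only on $x^1$, then $(I,\tilde g,V,\lambda,\mu)$ is an almost $\eta$-Ricci soliton if and only if $$\lambda=-f_1^2\left[\left(\frac{f_2'}{f_2}\right)'-\left(\frac{f_2'}{f_2}\right)^2\right]-f_2^2\left[\left(\frac{f_1'}{f_1}\right)'-\left(\frac{f_1'}{f_1}\right)^2\right]$$ and $$\mu=f_1^2\left[\left(\frac{f_2'}{f_2}\right)'-\left(\frac{f_2'}{f_2}\right)^2\right]+f_2^2\left[\left(\frac{f_1'}{f_1}\right)'-\left(\frac{f_1'}{f_1}\right)^2\right].$$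
   Context: Let $I=I_1\times I_2\times I_3\subseteq\mathbb R^3$ with $I_1,I_2,I_3\subseteq\mathbb R$ open intervals and standard coordinates $x^1,x^2,x^3$. Let $f_1,f_2$ be smooth nowhere zero functions on $I$ and endow $I$ with the Riemannian metric $\tilde g=\frac{1}{f_1^2}dx^1\otimes dx^1+\frac{1}{f_2^2}dx^2\otimes dx^2+dx^3\otimes dx^3$, with orthonormal frame $E_1=f_1\frac{\partial}{\partial x^1}$, $E_2=f_2\frac{\partial}{\partial x^2}$, $E_3=\frac{\partial}{\partial x^3}$. For a smooth vector field $V$, a $1$-form $\eta$, and smooth functions $\lambda,\mu$ on $I$ with $\mu\neq0$ (not identically zero), $(I,\tilde g,V,\lambda,\mu)$ is an almost $\eta$-Ricci soliton if $\frac12\pounds_V\tilde g+\mathrm{Ric}+\lambda\tilde g+\mu\,\eta\otimes\eta=0$ on $I$, where $\pounds_V\tilde g$ is the Lie derivative of $\tilde g$ along $V$ and $\mathrm{Ric}$ is the Ricci tensor of $\tilde g$, with $\mathrm{Ric}(Y,Z)=\sum_{k}\tilde g(R(E_k,Y)Z,E_k)$, $R(X,Y)Z=\nabla_X\nabla_YZ-\nabla_Y\nabla_XZ-\nabla_{[X,Y]}Z$, $\nabla$ the Levi-Civita connection. A prime denotes the derivative of a function of a single variable with respect to that variable. *)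

theory Defs
  imports "HOL-Analysis.Analysis"
begin

text \<open>Smoothness on an open set \<open>U\<close>, as existence and continuity of all iterated directional
  derivatives, each of which is required to be Frechet differentiable again.\<close>

primrec Ck_on :: "nat \<Rightarrow> 'a::real_normed_vector set \<Rightarrow> ('a \<Rightarrow> 'b::real_normed_vector) \<Rightarrow> bool" where
  "Ck_on 0 U f \<longleftrightarrow> continuous_on U f"
| "Ck_on (Suc n) U f \<longleftrightarrow>
     (\<forall>x\<in>U. f differentiable (at x)) \<and>
     (\<forall>v. Ck_on n U (\<lambda>x. frechet_derivative f (at x) v))"

definition smooth_on :: "'a::real_normed_vector set \<Rightarrow> ('a \<Rightarrow> 'b::real_normed_vector) \<Rightarrow> bool" where
  "smooth_on U f \<longleftrightarrow> (\<forall>n. Ck_on n U f)"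

text \<open>On an open \<open>U \<subseteq> \<real>\<^sup>n\<close> every tangent space is identified with \<open>\<real>\<^sup>n\<close> through the coordinate
  basis \<open>\<partial>/\<partial>x\<^sup>i = axis i 1\<close>. Vector fields and tensors are total functions of the base point;
  only their values on \<open>U\<close> are meaningful.\<close>

type_synonym 'n vfield = "real^'n \<Rightarrow> real^'n"
type_synonym 'n form1 = "real^'n \<Rightarrow> real^'n \<Rightarrow> real"
type_synonym 'n tensor2 = "real^'n \<Rightarrow> real^'n \<Rightarrow> real^'n \<Rightarrow> real"
type_synonym 'n conn = "'n vfield \<Rightarrow> 'n vfield \<Rightarrow> 'n vfield"

definition smooth_form1_on :: "(real^'n) set \<Rightarrow> 'n form1 \<Rightarrow> bool" where
  "smooth_form1_on U \<eta> \<longleftrightarrow> (\<forall>x\<in>U. linear (\<eta> x)) \<and> (\<forall>v. smooth_on U (\<lambda>x. \<eta> x v))"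

definition riemannian_metric_on :: "(real^'n) set \<Rightarrow> 'n tensor2 \<Rightarrow> bool" where
  "riemannian_metric_on U g \<longleftrightarrow>
     (\<forall>x\<in>U. bilinear (g x)) \<and>
     (\<forall>x\<in>U. \<forall>u v. g x u v = g x v u) \<and>
     (\<forall>x\<in>U. \<forall>v. v \<noteq> 0 \<longrightarrow> g x v v > 0) \<and>
     (\<forall>u v. smooth_on U (\<lambda>x. g x u v))"

definition orthonormal_frame_on :: "(real^'n) set \<Rightarrow> 'n tensor2 \<Rightarrow> ('n \<Rightarrow> 'n vfield) \<Rightarrow> bool" where
  "orthonormal_frame_on U g E \<longleftrightarrow>
     (\<forall>k. smooth_on U (E k)) \<and>
     (\<forall>x\<in>U. \<forall>j k. g x (E j x) (E k x) = (if j = k then 1 else 0))"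

text \<open>The action \<open>X f\<close> of a vector field on a function.\<close>

definition dir_deriv :: "'n::finite vfield \<Rightarrow> (real^'n \<Rightarrow> real) \<Rightarrow> real^'n \<Rightarrow> real" where
  "dir_deriv X f x = frechet_derivative f (at x) (X x)"

text \<open>In coordinates \<open>[X,Y]\<^sup>k = X(Y\<^sup>k) - Y(X\<^sup>k)\<close>.\<close>

definition lie_bracket :: "'n::finite vfield \<Rightarrow> 'n vfield \<Rightarrow> 'n vfield" where
  "lie_bracket X Y x = (\<chi> k. dir_deriv X (\<lambda>y. Y y $ k) x - dir_deriv Y (\<lambda>y. X y $ k) x)"

text \<open>\<open>(\<pounds>\<^sub>V g)(Y,Z) = V(g(Y,Z)) - g([V,Y],Z) - g(Y,[V,Z])\<close>.\<close>

definition lie_deriv2 ::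
  "'n::finite vfield \<Rightarrow> 'n tensor2 \<Rightarrow> 'n vfield \<Rightarrow> 'n vfield \<Rightarrow> real^'n \<Rightarrow> real" where
  "lie_deriv2 V g Y Z x =
     dir_deriv V (\<lambda>y. g y (Y y) (Z y)) x
     - g x (lie_bracket V Y x) (Z x) - g x (Y x) (lie_bracket V Z x)"

definition affine_connection_on :: "(real^'n::finite) set \<Rightarrow> 'n conn \<Rightarrow> bool" where
  "affine_connection_on U D \<longleftrightarrow>
     (\<forall>X Y. smooth_on U X \<longrightarrow> smooth_on U Y \<longrightarrow> smooth_on U (D X Y)) \<and>
     (\<forall>X Y Z. smooth_on U X \<longrightarrow> smooth_on U Y \<longrightarrow> smooth_on U Z \<longrightarrow>
        (\<forall>x\<in>U. D (\<lambda>y. X y + Y y) Z x = D X Z x + D Y Z x)) \<and>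
     (\<forall>X Y Z. smooth_on U X \<longrightarrow> smooth_on U Y \<longrightarrow> smooth_on U Z \<longrightarrow>
        (\<forall>x\<in>U. D X (\<lambda>y. Y y + Z y) x = D X Y x + D X Z x)) \<and>
     (\<forall>f X Y. smooth_on U f \<longrightarrow> smooth_on U X \<longrightarrow> smooth_on U Y \<longrightarrow>
        (\<forall>x\<in>U. D (\<lambda>y. f y *\<^sub>R X y) Y x = f x *\<^sub>R D X Y x)) \<and>
     (\<forall>f X Y. smooth_on U f \<longrightarrow> smooth_on U X \<longrightarrow> smooth_on U Y \<longrightarrow>
        (\<forall>x\<in>U. D X (\<lambda>y. f y *\<^sub>R Y y) x = f x *\<^sub>R D X Y x + dir_deriv X f x *\<^sub>R Y x))"

definition is_levi_civita_on :: "(real^'n::finite) set \<Rightarrow> 'n tensor2 \<Rightarrow> 'n conn \<Rightarrow> bool" where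
  "is_levi_civita_on U g D \<longleftrightarrow>
     affine_connection_on U D \<and>
     (\<forall>X Y. smooth_on U X \<longrightarrow> smooth_on U Y \<longrightarrow>
        (\<forall>x\<in>U. D X Y x - D Y X x = lie_bracket X Y x)) \<and>
     (\<forall>X Y Z. smooth_on U X \<longrightarrow> smooth_on U Y \<longrightarrow> smooth_on U Z \<longrightarrow>
        (\<forall>x\<in>U. dir_deriv X (\<lambda>y. g y (Y y) (Z y)) x = g x (D X Y x) (Z x) + g x (Y x) (D X Z x)))"

text \<open>By the fundamental theorem of Riemannian geometry the choice is unique, up to irrelevant values
  outside \<open>U\<close> and on fields that are not smooth on \<open>U\<close>.\<close>

definition levi_civita :: "(real^'n::finite) set \<Rightarrow> 'n tensor2 \<Rightarrow> 'n conn" where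
  "levi_civita U g = (SOME D. is_levi_civita_on U g D)"

definition curvature :: "'n::finite conn \<Rightarrow> 'n vfield \<Rightarrow> 'n vfield \<Rightarrow> 'n vfield \<Rightarrow> 'n vfield" where
  "curvature D X Y Z x = D X (D Y Z) x - D Y (D X Z) x - D (lie_bracket X Y) Z x"

definition ricci ::
  "(real^'n::finite) set \<Rightarrow> 'n tensor2 \<Rightarrow> ('n \<Rightarrow> 'n vfield) \<Rightarrow> 'n vfield \<Rightarrow> 'n vfield \<Rightarrow> real^'n \<Rightarrow> real" where
  "ricci U g E Y Z x = (\<Sum>k\<in>UNIV. g x (curvature (levi_civita U g) (E k) Y Z x) (E k x))"

text \<open>The frame \<open>E\<close> enters only through \<open>ricci\<close>, whose value is the same for every orthonormal frame.\<close>

definition almost_eta_ricci_soliton_on ::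
  "(real^'n::finite) set \<Rightarrow> 'n tensor2 \<Rightarrow> ('n \<Rightarrow> 'n vfield) \<Rightarrow> 'n vfield \<Rightarrow> 'n form1
     \<Rightarrow> (real^'n \<Rightarrow> real) \<Rightarrow> (real^'n \<Rightarrow> real) \<Rightarrow> bool" where
  "almost_eta_ricci_soliton_on U g E V \<eta> l m \<longleftrightarrow>
     riemannian_metric_on U g \<and> orthonormal_frame_on U g E \<and>
     smooth_on U V \<and> smooth_form1_on U \<eta> \<and> smooth_on U l \<and> smooth_on U m \<and> (\<exists>x\<in>U. m x \<noteq> 0) \<and>
     (\<forall>Y Z. smooth_on U Y \<longrightarrow> smooth_on U Z \<longrightarrow>
        (\<forall>x\<in>U. (1/2) * lie_deriv2 V g Y Z x + ricci U g E Y Z x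
               + l x * g x (Y x) (Z x) + m x * (\<eta> x (Y x) * \<eta> x (Z x)) = 0))"

definition box3 :: "real set \<Rightarrow> real set \<Rightarrow> real set \<Rightarrow> (real^3) set" where
  "box3 I1 I2 I3 = {x. x $ 1 \<in> I1 \<and> x $ 2 \<in> I2 \<and> x $ 3 \<in> I3}"

definition g_tilde :: "(real^3 \<Rightarrow> real) \<Rightarrow> (real^3 \<Rightarrow> real) \<Rightarrow> 3 tensor2" where
  "g_tilde f1 f2 x u v =
     1 / (f1 x)\<^sup>2 * (u $ 1 * v $ 1) + 1 / (f2 x)\<^sup>2 * (u $ 2 * v $ 2) + u $ 3 * v $ 3"

definition frame_tilde :: "(real^3 \<Rightarrow> real) \<Rightarrow> (real^3 \<Rightarrow> real) \<Rightarrow> 3 \<Rightarrow> 3 vfield" where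
  "frame_tilde f1 f2 k x =
     (if k = 1 then f1 x *\<^sub>R axis 1 1 else if k = 2 then f2 x *\<^sub>R axis 2 1 else axis 3 1)"

end

(* The metric is a product of a surface with a line, and V is the Killing field along the line, so
   the Lie derivative vanishes and the Ricci tensor is K times the surface part of the metric, with K
   the Gauss curvature.  The soliton equation is thus
   (K + lambda) g + (mu - K) eta (x) eta = 0, i.e. lambda = -K and mu = K.
   As the Levi-Civita connection is only given by a choice, it is identified on smooth fields with the
   connection of the explicit Christoffel symbols. *)

theory Submission
  imports Defs
begin

section \<open>Smooth functions and symmetry of second derivatives\<close>

text \<open>The chosen connection says nothing until some Levi-Civita connection is exhibited; the
  explicit Christoffel symbols supply this witness and also make the curvature computable.
  Connections act on total fields, but are determined only on \<open>U\<close> and only for smooth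
  fields. Two Levi-Civita connections thus produce derivative fields that agree on \<open>U\<close>
  and may differ elsewhere. Curvature differentiates such fields once more, so locality has to be
  derived from the Leibniz rule before one connection can replace the other.

  The soliton equation quantifies over all smooth \<open>Y\<close> and \<open>Z\<close>, not just
  over frame fields. Tensoriality of the curvature is therefore part of the work: the second
  derivatives of \<open>Z\<close> must cancel, which rests on the symmetry of second derivatives,
  proved here directly from the definition of smoothness by iterated directional derivatives. The
  primes in the formulas are derivatives of one-variable functions \<open>h1\<close> and
  \<open>h2\<close>, whose differentiability is recovered from that of \<open>f1\<close> and
  \<open>f2\<close> along coordinate lines.\<close>

lemma frechet_derivative_eqI:
  "(f has_derivative f') (at x) \<Longrightarrow> frechet_derivative f (at x) v = f' v"
  using frechet_derivative_at by metis

text \<open>Functions are total but matter only on \<open>U\<close>; openness makes Frechet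
  derivatives at points of \<open>U\<close> blind to the values elsewhere.\<close>

lemma Ck_on_cong:
  assumes "open U" "\<And>x. x \<in> U \<Longrightarrow> f x = g x" "Ck_on n U f"
  shows "Ck_on n U g"
  using assms(2,3)
proof (induction n arbitrary: f g)
  case 0
  have "continuous_on U g"
    by (rule continuous_on_eq[of U f]) (use 0 in \<open>simp_all\<close>)
  then show ?case by simp
next
  case (Suc n)
  have d: "(g has_derivative frechet_derivative f (at x)) (at x)" if "x \<in> U" for x
  proof (rule has_derivative_transform_within_open[OF _ assms(1) that])
    show "(f has_derivative frechet_derivative f (at x)) (at x)"
      using Suc.prems(2) that unfolding frechet_derivative_works[symmetric] by simp
  qed (rule Suc.prems(1))
  have "Ck_on n U (\<lambda>x. frechet_derivative g (at x) v)" for v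
  proof (rule Suc.IH)
    show "Ck_on n U (\<lambda>x. frechet_derivative f (at x) v)"
      using Suc.prems(2) by simp
  qed (simp add: frechet_derivative_eqI[OF d])
  then show ?case using d by (auto intro: differentiableI)
qed

lemma smooth_on_cong:
  assumes "open U" "\<And>x. x \<in> U \<Longrightarrow> f x = g x"
  shows "smooth_on U f \<longleftrightarrow> smooth_on U g"
  using Ck_on_cong[OF assms(1)] assms(2) unfolding smooth_on_def by metis

text \<open>Lets the closure proofs below work with an explicit derivative formula that is valid on
  \<open>U\<close>.\<close>

lemma Ck_on_SucI:
  assumes "open U" "\<And>x. x \<in> U \<Longrightarrow> (f has_derivative f' x) (at x)"
    and "\<And>v. Ck_on n U (\<lambda>x. f' x v)"
  shows "Ck_on (Suc n) U f"
proof -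
  have "Ck_on n U (\<lambda>x. frechet_derivative f (at x) v)" for v
    using frechet_derivative_eqI[OF assms(2)] by (intro Ck_on_cong[OF assms(1) _ assms(3)[of v]]) auto
  then show ?thesis using assms(2) by (auto intro: differentiableI)
qed

lemma Ck_on_SucD:
  assumes "Ck_on (Suc n) U f" "x \<in> U"
  shows "(f has_derivative frechet_derivative f (at x)) (at x)"
  using assms frechet_derivative_works by auto

lemma Ck_on_lower: "Ck_on (Suc n) U f \<Longrightarrow> Ck_on n U f"
proof (induction n arbitrary: f)
  case 0
  then show ?case
    by (auto intro!: continuous_at_imp_continuous_on differentiable_imp_continuous_within)
next
  case (Suc n)
  have "Ck_on (Suc n) U (\<lambda>x. frechet_derivative f (at x) v)" for v
    using Suc.prems unfolding Ck_on.simps(2)[of "Suc n"] by blast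
  then have "Ck_on n U (\<lambda>x. frechet_derivative f (at x) v)" for v
    using Suc.IH by blast
  then show ?case using Suc.prems by simp
qed

section \<open>Closure properties of smooth functions\<close>

lemma Ck_on_const: "Ck_on n U (\<lambda>x. c)"
  by (induction n arbitrary: c) auto

lemma Ck_on_bounded_linear:
  assumes "open U" "bounded_linear L" "Ck_on n U f"
  shows "Ck_on n U (\<lambda>x. L (f x))"
  using assms(3)
proof (induction n arbitrary: f)
  case 0
  then show ?case by (simp add: bounded_linear.continuous_on[OF assms(2)])
next
  case (Suc n)
  have "Ck_on n U (\<lambda>x. L (frechet_derivative f (at x) v))" for v
    using Suc.prems by (intro Suc.IH) auto
  moreover have "((\<lambda>x. L (f x)) has_derivative (\<lambda>v. L (frechet_derivative f (at x) v))) (at x)"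
    if "x \<in> U" for x
    using Suc.prems that by (intro bounded_linear.has_derivative[OF assms(2)] Ck_on_SucD)
  ultimately show ?case by (rule Ck_on_SucI[OF assms(1), rotated])
qed

lemma Ck_on_add:
  assumes "open U" "Ck_on n U f" "Ck_on n U g"
  shows "Ck_on n U (\<lambda>x. f x + g x)"
  using assms(2,3)
proof (induction n arbitrary: f g)
  case 0
  then show ?case by (auto intro: continuous_intros)
next
  case (Suc n)
  have "Ck_on n U (\<lambda>x. frechet_derivative f (at x) v + frechet_derivative g (at x) v)" for v
    using Suc.prems by (intro Suc.IH) auto
  moreover have "((\<lambda>x. f x + g x) has_derivative
      (\<lambda>v. frechet_derivative f (at x) v + frechet_derivative g (at x) v)) (at x)" if "x \<in> U" for x
    using Suc.prems that by (intro has_derivative_add Ck_on_SucD)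
  ultimately show ?case by (rule Ck_on_SucI[OF assms(1), rotated])
qed

text \<open>The Leibniz formula pairs a differentiated factor with an undifferentiated one;
  \<open>Ck_on_lower\<close> brings the latter down to order \<open>n\<close>, so the induction runs
  over all \<open>f\<close> and \<open>g\<close>. Scalar and real multiplication are both
  instances.\<close>

lemma Ck_on_bounded_bilinear:
  assumes "open U" "bounded_bilinear B" "Ck_on n U f" "Ck_on n U g"
  shows "Ck_on n U (\<lambda>x. B (f x) (g x))"
  using assms(3,4)
proof (induction n arbitrary: f g)
  case 0
  then show ?case by (simp add: bounded_bilinear.continuous_on[OF assms(2)])
next
  case (Suc n)
  have "Ck_on n U (\<lambda>x. B (f x) (frechet_derivative g (at x) v) + B (frechet_derivative f (at x) v) (g x))" for v
    using Suc.prems Ck_on_lower[OF Suc.prems(1)] Ck_on_lower[OF Suc.prems(2)]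
    by (intro Ck_on_add assms(1) Suc.IH) auto
  moreover have "((\<lambda>x. B (f x) (g x)) has_derivative
      (\<lambda>v. B (f x) (frechet_derivative g (at x) v) + B (frechet_derivative f (at x) v) (g x))) (at x)"
    if "x \<in> U" for x
    using Suc.prems that by (intro bounded_bilinear.FDERIV[OF assms(2)] Ck_on_SucD)
  ultimately show ?case by (rule Ck_on_SucI[OF assms(1), rotated])
qed

text \<open>The derivative of the inverse contains the inverse itself, but only order
  \<open>n\<close> of it is required, which the induction hypothesis supplies.\<close>

lemma Ck_on_inverse:
  fixes f :: "'a::real_normed_vector \<Rightarrow> real"
  assumes "open U" "\<And>x. x \<in> U \<Longrightarrow> f x \<noteq> 0" "Ck_on n U f"
  shows "Ck_on n U (\<lambda>x. inverse (f x))"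
  using assms(3)
proof (induction n)
  case 0
  then show ?case using assms(2) by (auto intro: continuous_on_inverse)
next
  case (Suc n)
  note mult = Ck_on_bounded_bilinear[OF assms(1) bounded_bilinear_mult]
  have *: "Ck_on n U (\<lambda>x. inverse (f x))" using Suc.IH Ck_on_lower[OF Suc.prems] .
  have "Ck_on n U (\<lambda>x. (-1) * (inverse (f x) * frechet_derivative f (at x) v * inverse (f x)))" for v
    using Suc.prems by (intro mult Ck_on_const *) auto
  then have "Ck_on n U (\<lambda>x. - (inverse (f x) * frechet_derivative f (at x) v * inverse (f x)))" for v
    by simp
  moreover have "((\<lambda>x. inverse (f x)) has_derivative
      (\<lambda>v. - (inverse (f x) * frechet_derivative f (at x) v * inverse (f x)))) (at x)" if "x \<in> U" for x
    using Suc.prems assms(2) that by (intro Deriv.has_derivative_inverse Ck_on_SucD)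
  ultimately show ?case by (rule Ck_on_SucI[OF assms(1), rotated])
qed

lemma smooth_on_const [simp]: "smooth_on U (\<lambda>x. c)"
  by (simp add: smooth_on_def Ck_on_const)

lemma smooth_on_add: "open U \<Longrightarrow> smooth_on U f \<Longrightarrow> smooth_on U g \<Longrightarrow> smooth_on U (\<lambda>x. f x + g x)"
  by (simp add: smooth_on_def Ck_on_add)

lemma smooth_on_bounded_linear:
  "open U \<Longrightarrow> bounded_linear L \<Longrightarrow> smooth_on U f \<Longrightarrow> smooth_on U (\<lambda>x. L (f x))"
  by (simp add: smooth_on_def Ck_on_bounded_linear)

lemma smooth_on_minus: "open U \<Longrightarrow> smooth_on U f \<Longrightarrow> smooth_on U (\<lambda>x. - f x)"
  using smooth_on_bounded_linear[OF _ bounded_linear_minus[OF bounded_linear_ident]] .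

lemma smooth_on_diff:
  assumes "open U" "smooth_on U f" "smooth_on U g"
  shows "smooth_on U (\<lambda>x. f x - g x)"
  using smooth_on_add[OF assms(1,2) smooth_on_minus[OF assms(1,3)]] by simp

lemma smooth_on_scaleR:
  "open U \<Longrightarrow> smooth_on U f \<Longrightarrow> smooth_on U g \<Longrightarrow> smooth_on U (\<lambda>x. f x *\<^sub>R g x)"
  by (simp add: smooth_on_def Ck_on_bounded_bilinear[OF _ bounded_bilinear_scaleR])

lemma smooth_on_mult:
  fixes f g :: "'a::real_normed_vector \<Rightarrow> real"
  shows "open U \<Longrightarrow> smooth_on U f \<Longrightarrow> smooth_on U g \<Longrightarrow> smooth_on U (\<lambda>x. f x * g x)"
  by (simp add: smooth_on_def Ck_on_bounded_bilinear[OF _ bounded_bilinear_mult])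

lemma smooth_on_power:
  fixes f :: "'a::real_normed_vector \<Rightarrow> real"
  assumes "open U" "smooth_on U f"
  shows "smooth_on U (\<lambda>x. f x ^ n)"
  by (induction n) (auto intro: smooth_on_mult assms)

lemma smooth_on_divide:
  fixes f g :: "'a::real_normed_vector \<Rightarrow> real"
  assumes "open U" "smooth_on U f" "smooth_on U g" "\<And>x. x \<in> U \<Longrightarrow> g x \<noteq> 0"
  shows "smooth_on U (\<lambda>x. f x / g x)"
proof -
  have "smooth_on U (\<lambda>x. inverse (g x))"
    using assms by (simp add: smooth_on_def Ck_on_inverse)
  then show ?thesis
    using smooth_on_mult[OF assms(1,2)] by (simp add: divide_inverse)
qed

lemma smooth_on_sum:
  assumes "open U" "\<And>i. i \<in> A \<Longrightarrow> smooth_on U (f i)"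
  shows "smooth_on U (\<lambda>x. \<Sum>i\<in>A. f i x)"
  using assms(2)
proof (induction A rule: infinite_finite_induct)
  case (insert a A)
  then show ?case by (simp add: smooth_on_add[OF assms(1)])
qed auto

lemma smooth_on_nth: "open U \<Longrightarrow> smooth_on U f \<Longrightarrow> smooth_on U (\<lambda>x. f x $ i)"
  by (rule smooth_on_bounded_linear[OF _ bounded_linear_vec_nth])

lemma vec_basis_sum: "(\<Sum>i\<in>UNIV. v $ i *\<^sub>R axis i 1) = (v :: real^'n)"
  using basis_expansion[of v] by (simp add: scalar_mult_eq_scaleR)

lemma smooth_on_vecI:
  fixes f :: "'a::real_normed_vector \<Rightarrow> real^'n"
  assumes "open U" "\<And>i. smooth_on U (\<lambda>x. f x $ i)"
  shows "smooth_on U f"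
proof -
  have "smooth_on U (\<lambda>x. \<Sum>i\<in>UNIV. f x $ i *\<^sub>R (axis i 1 :: real^'n))"
    by (intro smooth_on_sum smooth_on_scaleR assms smooth_on_const)
  then show ?thesis
    by (simp add: vec_basis_sum)
qed

lemma smooth_on_frechet_derivative:
  "smooth_on U f \<Longrightarrow> smooth_on U (\<lambda>x. frechet_derivative f (at x) v)"
  unfolding smooth_on_def using Ck_on.simps(2) by blast

lemma smooth_on_has_derivative:
  "smooth_on U f \<Longrightarrow> x \<in> U \<Longrightarrow> (f has_derivative frechet_derivative f (at x)) (at x)"
  unfolding smooth_on_def using Ck_on_SucD by blast

lemma smooth_on_continuous: "smooth_on U f \<Longrightarrow> continuous_on U f"
  unfolding smooth_on_def using Ck_on.simps(1) by blast

section \<open>Symmetry of mixed second derivatives\<close>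

lemma second_difference_mvt:
  fixes f :: "'a::real_normed_vector \<Rightarrow> real"
  assumes f: "\<And>y. y \<in> U \<Longrightarrow> (f has_derivative f' y) (at y)"
    and f': "\<And>y. y \<in> U \<Longrightarrow> ((\<lambda>y. f' y v) has_derivative f'' y) (at y)"
    and h: "0 < h" and U: "\<And>s t. \<lbrakk>0 \<le> s; s \<le> h; 0 \<le> t; t \<le> h\<rbrakk> \<Longrightarrow> x + s *\<^sub>R v + t *\<^sub>R w \<in> U"
  obtains s t where "0 \<le> s" "s \<le> h" "0 \<le> t" "t \<le> h"
    "f (x + h *\<^sub>R v + h *\<^sub>R w) - f (x + h *\<^sub>R v) - f (x + h *\<^sub>R w) + f x
     = h * h * f'' (x + s *\<^sub>R v + t *\<^sub>R w) w"
proof -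
  have D: "((\<lambda>s. f (x + s *\<^sub>R v + t *\<^sub>R w)) has_real_derivative f' (x + s *\<^sub>R v + t *\<^sub>R w) v) (at s)"
    if st: "0 \<le> s" "s \<le> h" "0 \<le> t" "t \<le> h" for s t
  proof -
    have "((\<lambda>s. f (x + s *\<^sub>R v + t *\<^sub>R w)) has_derivative (\<lambda>r. f' (x + s *\<^sub>R v + t *\<^sub>R w) (r *\<^sub>R v))) (at s)"
      by (rule has_derivative_compose[where g=f and f="\<lambda>s. x + s *\<^sub>R v + t *\<^sub>R w", OF _ f[OF U[OF st]]]) (auto intro!: derivative_eq_intros)
    moreover have "f' (x + s *\<^sub>R v + t *\<^sub>R w) (r *\<^sub>R v) = f' (x + s *\<^sub>R v + t *\<^sub>R w) v * r" for r
      using linear_scale[OF has_derivative_linear[OF f[OF U[OF st]]]] by simp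
    ultimately show ?thesis by (simp add: has_field_derivative_def)
  qed
  have D': "((\<lambda>t. f' (x + s *\<^sub>R v + t *\<^sub>R w) v) has_real_derivative f'' (x + s *\<^sub>R v + t *\<^sub>R w) w) (at t)"
    if st: "0 \<le> s" "s \<le> h" "0 \<le> t" "t \<le> h" for s t
  proof -
    have "((\<lambda>t. f' (x + s *\<^sub>R v + t *\<^sub>R w) v) has_derivative (\<lambda>r. f'' (x + s *\<^sub>R v + t *\<^sub>R w) (r *\<^sub>R w))) (at t)"
      by (rule has_derivative_compose[where g="\<lambda>y. f' y v" and f="\<lambda>t. x + s *\<^sub>R v + t *\<^sub>R w", OF _ f'[OF U[OF st]]]) (auto intro!: derivative_eq_intros)
    moreover have "f'' (x + s *\<^sub>R v + t *\<^sub>R w) (r *\<^sub>R w) = f'' (x + s *\<^sub>R v + t *\<^sub>R w) w * r" for r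
      using linear_scale[OF has_derivative_linear[OF f'[OF U[OF st]]]] by simp
    ultimately show ?thesis by (simp add: has_field_derivative_def)
  qed
  \<comment> \<open>The mean value theorem is applied along \<open>v\<close> to the difference of
    \<open>f\<close> between the offsets \<open>h\<close> and \<open>0\<close> along
    \<open>w\<close>. It leaves a difference of \<open>f'\<close> along \<open>w\<close>, to which
    it applies again. The offsets \<open>0\<close> and \<open>h\<close> are boundary values, hence
    the closed parameter square in the hypothesis.\<close>
  have "\<exists>s. 0 < s \<and> s < h \<and>
    (f (x + h *\<^sub>R v + h *\<^sub>R w) - f (x + h *\<^sub>R v + 0 *\<^sub>R w)) - (f (x + 0 *\<^sub>R v + h *\<^sub>R w) - f (x + 0 *\<^sub>R v + 0 *\<^sub>R w))
     = (h - 0) * (f' (x + s *\<^sub>R v + h *\<^sub>R w) v - f' (x + s *\<^sub>R v + 0 *\<^sub>R w) v)"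
    using h by (intro MVT2 DERIV_diff D) auto
  then obtain s where s: "0 < s" "s < h"
    "f (x + h *\<^sub>R v + h *\<^sub>R w) - f (x + h *\<^sub>R v) - (f (x + h *\<^sub>R w) - f x)
     = h * (f' (x + s *\<^sub>R v + h *\<^sub>R w) v - f' (x + s *\<^sub>R v + 0 *\<^sub>R w) v)"
    by auto
  have "\<exists>t. 0 < t \<and> t < h \<and>
    f' (x + s *\<^sub>R v + h *\<^sub>R w) v - f' (x + s *\<^sub>R v + 0 *\<^sub>R w) v = (h - 0) * f'' (x + s *\<^sub>R v + t *\<^sub>R w) w"
    using h s by (intro MVT2 D') auto
  then obtain t where t: "0 < t" "t < h"
    "f' (x + s *\<^sub>R v + h *\<^sub>R w) v - f' (x + s *\<^sub>R v + 0 *\<^sub>R w) v = h * f'' (x + s *\<^sub>R v + t *\<^sub>R w) w"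
    by auto
  show ?thesis by (rule that[of s t]) (use s t in simp_all)
qed

text \<open>The second difference over the parallelogram spanned by \<open>h v\<close> and
  \<open>h w\<close> is the same in either order of \<open>v\<close> and \<open>w\<close>. So the
  two mixed derivatives share a value, taken at possibly different points of the parallelogram, and
  continuity at \<open>x\<close> excludes a gap once it is small.\<close>

lemma symmetric_second_derivative:
  fixes f :: "'a::real_normed_vector \<Rightarrow> real"
  assumes "open U" "x \<in> U" "smooth_on U f"
  shows "frechet_derivative (\<lambda>y. frechet_derivative f (at y) v) (at x) w
       = frechet_derivative (\<lambda>y. frechet_derivative f (at y) w) (at x) v"
    (is "?A x = ?B x")
proof (rule ccontr)
  assume "?A x \<noteq> ?B x"
  \<comment> \<open>Half the gap: two equal numbers cannot lie within \<open>e\<close> of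
    \<open>?A x\<close> and of \<open>?B x\<close> respectively.\<close>
  define e where "e = \<bar>?A x - ?B x\<bar> / 2"
  have e: "e > 0" using \<open>?A x \<noteq> ?B x\<close> by (simp add: e_def)
  have "continuous_on U ?A" "continuous_on U ?B"
    by (intro smooth_on_continuous smooth_on_frechet_derivative assms)+
  then have "isCont ?A x" "isCont ?B x"
    using assms continuous_on_eq_continuous_at by blast+
  then have "(?A \<longlongrightarrow> ?A x) (nhds x)" "(?B \<longlongrightarrow> ?B x) (nhds x)"
    unfolding isCont_def using tendsto_at_iff_tendsto_nhds[where g="?A"] tendsto_at_iff_tendsto_nhds[where g="?B"]
    by blast+
  then have "\<forall>\<^sub>F y in nhds x. dist (?A y) (?A x) < e \<and> dist (?B y) (?B x) < e \<and> y \<in> U"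
    using e assms by (intro eventually_conj tendstoD eventually_nhds_in_open)
  then obtain d where d: "d > 0" "\<And>y. dist y x < d \<Longrightarrow> dist (?A y) (?A x) < e \<and> dist (?B y) (?B x) < e \<and> y \<in> U"
    unfolding eventually_nhds_metric by blast
  \<comment> \<open>Keeps the whole parallelogram within distance \<open>d\<close> of
    \<open>x\<close>; the summand \<open>1\<close> covers \<open>v = w = 0\<close> and makes the
    bound strict.\<close>
  define h where "h = d / (norm v + norm w + 1)"
  have h: "h > 0" using d by (simp add: h_def add_nonneg_pos)
  have near: "dist (x + s *\<^sub>R v + t *\<^sub>R w) x < d" if "0 \<le> s" "s \<le> h" "0 \<le> t" "t \<le> h" for s t
  proof -
    have "dist (x + s *\<^sub>R v + t *\<^sub>R w) x = norm (s *\<^sub>R v + t *\<^sub>R w)"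
      by (simp add: dist_norm algebra_simps)
    also have "\<dots> \<le> s * norm v + t * norm w"
      using norm_triangle_ineq[of "s *\<^sub>R v" "t *\<^sub>R w"] that by simp
    also have "\<dots> \<le> h * norm v + h * norm w"
      using that by (intro add_mono mult_right_mono) auto
    also have "\<dots> < h * (norm v + norm w + 1)" using h by (simp add: algebra_simps)
    also have "\<dots> = d"
      using add_nonneg_pos[of "norm v + norm w" 1] by (simp add: h_def)
    finally show ?thesis .
  qed
  note diff = smooth_on_has_derivative[OF assms(3)]
    smooth_on_has_derivative[OF smooth_on_frechet_derivative[OF assms(3)]]
  note mvt = second_difference_mvt[where U=U and f=f and x=x and f'="\<lambda>y. frechet_derivative f (at y)", OF diff(1) _ h]
  have swap: "x + a *\<^sub>R w + b *\<^sub>R v = x + b *\<^sub>R v + a *\<^sub>R w" for a b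
    by simp
  obtain s t where st: "0 \<le> s" "s \<le> h" "0 \<le> t" "t \<le> h" and
    1: "f (x + h *\<^sub>R v + h *\<^sub>R w) - f (x + h *\<^sub>R v) - f (x + h *\<^sub>R w) + f x
       = h * h * ?A (x + s *\<^sub>R v + t *\<^sub>R w)"
    by (rule mvt[where v=v and w=w and f''="\<lambda>y. frechet_derivative (\<lambda>z. frechet_derivative f (at z) v) (at y)"])
      (use d near diff in auto)
  obtain s' t' where st': "0 \<le> s'" "s' \<le> h" "0 \<le> t'" "t' \<le> h" and
    2: "f (x + h *\<^sub>R w + h *\<^sub>R v) - f (x + h *\<^sub>R w) - f (x + h *\<^sub>R v) + f x
       = h * h * ?B (x + s' *\<^sub>R w + t' *\<^sub>R v)"
    by (rule mvt[where v=w and w=v and f''="\<lambda>y. frechet_derivative (\<lambda>z. frechet_derivative f (at z) w) (at y)"])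
      (use d near diff in \<open>auto simp: swap\<close>)
  have "h * h * ?A (x + s *\<^sub>R v + t *\<^sub>R w) = h * h * ?B (x + t' *\<^sub>R v + s' *\<^sub>R w)"
    using 1 2 unfolding swap by linarith
  then have "?A (x + s *\<^sub>R v + t *\<^sub>R w) = ?B (x + t' *\<^sub>R v + s' *\<^sub>R w)" using h by simp
  moreover have "dist (?A (x + s *\<^sub>R v + t *\<^sub>R w)) (?A x) < e" "dist (?B (x + t' *\<^sub>R v + s' *\<^sub>R w)) (?B x) < e"
    using d near st st' by blast+
  ultimately show False unfolding e_def dist_real_def by argo
qed

section \<open>Differentiation along vector fields\<close>

text \<open>Extends \<open>dir_deriv\<close> to maps into any normed space, so that a vector field
  is differentiated as a whole rather than entry by entry.\<close>

definition vderiv :: "'n::finite vfield \<Rightarrow> (real^'n \<Rightarrow> 'b::real_normed_vector) \<Rightarrow> real^'n \<Rightarrow> 'b" where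
  "vderiv X F x = frechet_derivative F (at x) (X x)"

lemma dir_deriv_eq_vderiv: "dir_deriv = vderiv"
  by (simp add: fun_eq_iff dir_deriv_def vderiv_def)

lemma vderiv_eqI: "(F has_derivative F') (at x) \<Longrightarrow> vderiv X F x = F' (X x)"
  unfolding vderiv_def by (rule frechet_derivative_eqI)

lemma vderiv_const [simp]: "vderiv X (\<lambda>y. c) x = 0"
  by (simp add: vderiv_def)

context
  fixes U :: "(real^'n::finite) set" and x :: "real^'n"
  assumes x: "x \<in> U"
begin

lemma vderiv_cong:
  assumes "open U" "smooth_on U F" "\<And>y. y \<in> U \<Longrightarrow> F y = G y"
  shows "vderiv X F x = vderiv X G x"
proof -
  have "(G has_derivative frechet_derivative F (at x)) (at x)"
    by (rule has_derivative_transform_within_open[OF smooth_on_has_derivative[OF assms(2) x] assms(1) x assms(3)])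
  then have "vderiv X G x = frechet_derivative F (at x) (X x)" by (rule vderiv_eqI)
  then show ?thesis by (simp add: vderiv_def)
qed

lemma vderiv_bounded_linear:
  assumes "bounded_linear L" "smooth_on U F"
  shows "vderiv X (\<lambda>y. L (F y)) x = L (vderiv X F x)"
  unfolding vderiv_def[of X F]
  by (rule vderiv_eqI[OF bounded_linear.has_derivative[OF assms(1) smooth_on_has_derivative[OF assms(2) x]]])

lemma vderiv_nth: "smooth_on U F \<Longrightarrow> vderiv X (\<lambda>y. F y $ i) x = vderiv X F x $ i"
  by (rule vderiv_bounded_linear[OF bounded_linear_vec_nth])

lemma vderiv_add:
  assumes "smooth_on U F" "smooth_on U G"
  shows "vderiv X (\<lambda>y. F y + G y) x = vderiv X F x + vderiv X G x"
  unfolding vderiv_def[of X F] vderiv_def[of X G]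
  by (rule vderiv_eqI[OF has_derivative_add[OF assms[THEN smooth_on_has_derivative, OF x]]])

lemma vderiv_scaleR:
  assumes "smooth_on U f" "smooth_on U G"
  shows "vderiv X (\<lambda>y. f y *\<^sub>R G y) x = f x *\<^sub>R vderiv X G x + vderiv X f x *\<^sub>R G x"
  unfolding vderiv_def[of X f] vderiv_def[of X G]
  by (rule vderiv_eqI[OF has_derivative_scaleR[OF assms[THEN smooth_on_has_derivative, OF x]]])

lemma vderiv_sum:
  assumes "\<And>i. i \<in> A \<Longrightarrow> smooth_on U (F i)"
  shows "vderiv X (\<lambda>y. \<Sum>i\<in>A. F i y) x = (\<Sum>i\<in>A. vderiv X (F i) x)"
  unfolding vderiv_def[of X "F _"]
  by (rule vderiv_eqI[OF has_derivative_sum]) (rule smooth_on_has_derivative[OF assms x])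

lemma vderiv_basis:
  assumes "smooth_on U F"
  shows "vderiv X F x = (\<Sum>i\<in>UNIV. X x $ i *\<^sub>R frechet_derivative F (at x) (axis i 1))"
proof -
  interpret linear "frechet_derivative F (at x)"
    using smooth_on_has_derivative[OF assms x] has_derivative_linear by blast
  have "vderiv X F x = frechet_derivative F (at x) (\<Sum>i\<in>UNIV. X x $ i *\<^sub>R axis i 1)"
    unfolding vderiv_def vec_basis_sum ..
  then show ?thesis by (simp only: sum scaleR)
qed

lemma vderiv_field_add:
  assumes "smooth_on U F"
  shows "vderiv (\<lambda>y. X y + Y y) F x = vderiv X F x + vderiv Y F x"
  unfolding vderiv_def
  by (rule linear_add[OF has_derivative_linear[OF smooth_on_has_derivative[OF assms x]]])

lemma vderiv_field_scaleR:
  assumes "smooth_on U F"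
  shows "vderiv (\<lambda>y. f y *\<^sub>R X y) F x = f x *\<^sub>R vderiv X F x"
  unfolding vderiv_def
  by (rule linear_scale[OF has_derivative_linear[OF smooth_on_has_derivative[OF assms x]]])

lemma lie_bracket_eq_vderiv:
  assumes "smooth_on U X" "smooth_on U Y"
  shows "lie_bracket X Y x = vderiv X Y x - vderiv Y X x"
  by (simp add: vec_eq_iff lie_bracket_def dir_deriv_eq_vderiv vderiv_nth assms)

end

text \<open>Smoothness speaks of derivatives along fixed vectors only, so the varying direction is
  expanded in the coordinate basis.\<close>

lemma smooth_on_vderiv:
  fixes F :: "real^'n::finite \<Rightarrow> 'b::real_normed_vector"
  assumes "open U" "smooth_on U X" "smooth_on U F"
  shows "smooth_on U (vderiv X F)"
proof -
  have "smooth_on U (\<lambda>x. \<Sum>i\<in>UNIV. X x $ i *\<^sub>R frechet_derivative F (at x) (axis i 1))"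
    by (intro smooth_on_sum smooth_on_scaleR smooth_on_nth smooth_on_frechet_derivative assms)
  then show ?thesis
    by (subst smooth_on_cong[OF assms(1) vderiv_basis[OF _ assms(3)]])
qed

lemma smooth_on_lie_bracket:
  assumes "open U" "smooth_on U X" "smooth_on U Y"
  shows "smooth_on U (lie_bracket X Y)"
  by (subst smooth_on_cong[OF assms(1) lie_bracket_eq_vderiv[OF _ assms(2,3)]])
    (auto intro!: smooth_on_diff smooth_on_vderiv assms)

text \<open>In coordinates, the terms with second derivatives of \<open>f\<close> are unchanged when
  \<open>X\<close> and \<open>Y\<close> are exchanged and cancel; the first-order terms that remain
  form the derivative along the bracket.\<close>

lemma vderiv_commutator_real:
  fixes f :: "real^'n::finite \<Rightarrow> real"
  assumes U: "open U" "x \<in> U" and sm: "smooth_on U X" "smooth_on U Y" "smooth_on U f"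
  shows "vderiv X (vderiv Y f) x - vderiv Y (vderiv X f) x = vderiv (lie_bracket X Y) f x"
proof -
  define d where "d i y = frechet_derivative f (at y) (axis i 1)" for i y
  have d: "smooth_on U (d i)" for i
    unfolding d_def by (rule smooth_on_frechet_derivative[OF sm(3)])
  have XY: "vderiv A (vderiv B f) x =
      (\<Sum>i\<in>UNIV. vderiv A B x $ i *\<^sub>R d i x) +
      (\<Sum>i\<in>UNIV. \<Sum>j\<in>UNIV. (B x $ i * A x $ j) * frechet_derivative (d i) (at x) (axis j 1))"
    if "smooth_on U A" "smooth_on U B" for A B
  proof -
    have "vderiv A (vderiv B f) x = vderiv A (\<lambda>y. \<Sum>i\<in>UNIV. B y $ i *\<^sub>R d i y) x"
      unfolding d_def
      by (rule vderiv_cong[OF U(2,1) smooth_on_vderiv[OF U(1) that(2) sm(3)] vderiv_basis[OF _ sm(3)]])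
    also have "\<dots> = (\<Sum>i\<in>UNIV. B x $ i *\<^sub>R vderiv A (d i) x + vderiv A B x $ i *\<^sub>R d i x)"
      using U that d by (simp add: vderiv_sum[OF U(2)] vderiv_scaleR[OF U(2)] vderiv_nth[OF U(2)]
          smooth_on_scaleR smooth_on_nth del: real_scaleR_def)
    finally show ?thesis
      by (simp add: vderiv_basis[OF U(2) d] sum.distrib sum_distrib_left mult.assoc)
  qed
  have sym: "frechet_derivative (d i) (at x) (axis j 1) = frechet_derivative (d j) (at x) (axis i 1)" for i j
    unfolding d_def by (rule symmetric_second_derivative[OF U sm(3)])
  have "(\<Sum>i\<in>UNIV. \<Sum>j\<in>UNIV. (Y x $ i * X x $ j) * frechet_derivative (d i) (at x) (axis j 1))
      = (\<Sum>i\<in>UNIV. \<Sum>j\<in>UNIV. (X x $ i * Y x $ j) * frechet_derivative (d i) (at x) (axis j 1))"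
    by (subst sum.swap) (simp add: sym mult.commute)
  then have "vderiv X (vderiv Y f) x - vderiv Y (vderiv X f) x
      = (\<Sum>i\<in>UNIV. (vderiv X Y x - vderiv Y X x) $ i *\<^sub>R d i x)"
    unfolding XY[OF sm(1,2)] XY[OF sm(2,1)] by (simp add: sum_subtractf algebra_simps)
  also have "\<dots> = vderiv (lie_bracket X Y) f x"
    unfolding vderiv_basis[OF U(2) sm(3)] lie_bracket_eq_vderiv[OF U(2) sm(1,2)] d_def ..
  finally show ?thesis .
qed

lemma vderiv_commutator:
  fixes F :: "real^'n::finite \<Rightarrow> real^'m::finite"
  assumes U: "open U" "x \<in> U" and sm: "smooth_on U X" "smooth_on U Y" "smooth_on U F"
  shows "vderiv X (vderiv Y F) x - vderiv Y (vderiv X F) x = vderiv (lie_bracket X Y) F x"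
proof -
  have *: "vderiv A (vderiv B F) x $ i = vderiv A (vderiv B (\<lambda>y. F y $ i)) x"
    if "smooth_on U A" "smooth_on U B" for A B i
    unfolding vderiv_nth[OF U(2) smooth_on_vderiv[OF U(1) that(2) sm(3)], symmetric]
    using that U sm by (intro vderiv_cong[OF U(2,1)])
      (auto simp: vderiv_nth intro!: smooth_on_nth smooth_on_vderiv)
  show ?thesis
    using vderiv_commutator_real[OF U sm(1,2) smooth_on_nth[OF U(1) sm(3)]]
    by (simp add: vec_eq_iff * sm vderiv_nth[OF U(2) sm(3), symmetric])
qed

section \<open>Smooth fields of bilinear maps\<close>

lemma bilinear_basis_sum:
  fixes B :: "real^'n \<Rightarrow> real^'m \<Rightarrow> 'b::real_vector"
  assumes "bilinear B"
  shows "B u v = (\<Sum>i\<in>UNIV. \<Sum>j\<in>UNIV. (u $ i * v $ j) *\<^sub>R B (axis i 1) (axis j 1))"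
proof -
  have l: "linear (\<lambda>u. B u v)" "linear (B u)" for u v
    using assms by (auto simp: bilinear_def)
  have "B u v = B (\<Sum>i\<in>UNIV. u $ i *\<^sub>R axis i 1) v"
    unfolding vec_basis_sum ..
  also have "\<dots> = (\<Sum>i\<in>UNIV. u $ i *\<^sub>R B (axis i 1) v)"
    by (simp only: linear_sum[OF l(1)] linear_scale[OF l(1)])
  also have "\<dots> = (\<Sum>i\<in>UNIV. u $ i *\<^sub>R B (axis i 1) (\<Sum>j\<in>UNIV. v $ j *\<^sub>R axis j 1))"
    unfolding vec_basis_sum ..
  also have "\<dots> = (\<Sum>i\<in>UNIV. \<Sum>j\<in>UNIV. (u $ i * v $ j) *\<^sub>R B (axis i 1) (axis j 1))"
    by (simp only: linear_sum[OF l(2)] linear_scale[OF l(2)] scaleR_sum_right scaleR_scaleR)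
  finally show ?thesis .
qed

text \<open>The values lie in any normed space so that the metric and the Christoffel symbols are
  both instances.\<close>

definition smooth_bilinear_on ::
  "(real^'n) set \<Rightarrow> (real^'n \<Rightarrow> real^'n \<Rightarrow> real^'n \<Rightarrow> 'b::real_normed_vector) \<Rightarrow> bool" where
  "smooth_bilinear_on U B \<longleftrightarrow> (\<forall>x\<in>U. bilinear (B x)) \<and> (\<forall>u v. smooth_on U (\<lambda>x. B x u v))"

context
  fixes U :: "(real^'n::finite) set" and B :: "real^'n \<Rightarrow> real^'n \<Rightarrow> real^'n \<Rightarrow> 'b::real_normed_vector"
    and Y Z :: "'n vfield"
  assumes U: "open U" and B: "smooth_bilinear_on U B" and YZ: "smooth_on U Y" "smooth_on U Z"
begin

private lemma expand:
  "y \<in> U \<Longrightarrow> B y u v = (\<Sum>i\<in>UNIV. \<Sum>j\<in>UNIV. (u $ i * v $ j) *\<^sub>R B y (axis i 1) (axis j 1))"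
  using B unfolding smooth_bilinear_on_def by (intro bilinear_basis_sum) auto

lemma smooth_on_bilinear_field: "smooth_on U (\<lambda>y. B y (Y y) (Z y))"
  using B unfolding smooth_bilinear_on_def
  by (subst smooth_on_cong[OF U expand])
    (auto intro!: smooth_on_sum smooth_on_scaleR smooth_on_mult smooth_on_nth U YZ)

text \<open>A Leibniz rule with three factors, proved by expansion in the basis. The first term
  freezes \<open>Y\<close> and \<open>Z\<close> at \<open>x\<close> and differentiates only the
  coefficients of \<open>B\<close>; this separates the tensorial part from the derivatives of the
  fields in metric compatibility, Lie derivative and curvature.\<close>

lemma vderiv_bilinear:
  assumes x: "x \<in> U"
  shows "vderiv X (\<lambda>y. B y (Y y) (Z y)) x
    = vderiv X (\<lambda>y. B y (Y x) (Z x)) x + B x (vderiv X Y x) (Z x) + B x (Y x) (vderiv X Z x)"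
proof -
  define b where "b i j y = B y (axis i 1) (axis j 1)" for i j y
  have b: "smooth_on U (b i j)" for i j
    using B by (simp add: smooth_bilinear_on_def b_def[abs_def])
  note sm = smooth_on_sum smooth_on_scaleR[OF U] smooth_on_mult[OF U] smooth_on_nth[OF U] YZ b
  have mult: "vderiv X (\<lambda>y. f y * g y) x = f x * vderiv X g x + vderiv X f x * g x"
    if "smooth_on U f" "smooth_on U g" for f g :: "real^'n \<Rightarrow> real"
    using vderiv_scaleR[OF x that] by simp
  have "vderiv X (\<lambda>y. B y (Y y) (Z y)) x
      = vderiv X (\<lambda>y. \<Sum>i\<in>UNIV. \<Sum>j\<in>UNIV. (Y y $ i * Z y $ j) *\<^sub>R b i j y) x"
    unfolding b_def by (rule vderiv_cong[OF x U smooth_on_bilinear_field expand])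
  also have "\<dots> = (\<Sum>i\<in>UNIV. \<Sum>j\<in>UNIV. (Y x $ i * Z x $ j) *\<^sub>R vderiv X (b i j) x
      + (Y x $ i * vderiv X Z x $ j + vderiv X Y x $ i * Z x $ j) *\<^sub>R b i j x)"
    by (simp add: vderiv_sum[OF x] vderiv_scaleR[OF x] mult vderiv_nth[OF x] sm U)
  also have "\<dots> = (\<Sum>i\<in>UNIV. \<Sum>j\<in>UNIV. (Y x $ i * Z x $ j) *\<^sub>R vderiv X (b i j) x)
      + (\<Sum>i\<in>UNIV. \<Sum>j\<in>UNIV. (vderiv X Y x $ i * Z x $ j) *\<^sub>R b i j x)
      + (\<Sum>i\<in>UNIV. \<Sum>j\<in>UNIV. (Y x $ i * vderiv X Z x $ j) *\<^sub>R b i j x)"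
    by (simp add: sum.distrib algebra_simps)
  also have "(\<Sum>i\<in>UNIV. \<Sum>j\<in>UNIV. (Y x $ i * Z x $ j) *\<^sub>R vderiv X (b i j) x)
      = vderiv X (\<lambda>y. \<Sum>i\<in>UNIV. \<Sum>j\<in>UNIV. (Y x $ i * Z x $ j) *\<^sub>R b i j y) x"
    by (simp add: vderiv_sum[OF x] vderiv_scaleR[OF x] sm U)
  also have "\<dots> = vderiv X (\<lambda>y. B y (Y x) (Z x)) x"
    by (rule sym, unfold b_def, rule vderiv_cong[OF x U _ expand])
      (use B in \<open>auto simp: smooth_bilinear_on_def\<close>)
  finally show ?thesis
    by (simp only: b_def expand[OF x, of "vderiv X Y x" "Z x"] expand[OF x, of "Y x" "vderiv X Z x"])
qed

end

section \<open>Connections given by Christoffel symbols\<close>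

lemma riemannian_metric_on_smooth_bilinear: "riemannian_metric_on U g \<Longrightarrow> smooth_bilinear_on U g"
  by (simp add: riemannian_metric_on_def smooth_bilinear_on_def)

text \<open>Multiplying by the indicator function of the complement of \<open>U\<close>, which is smooth on \<open>U\<close>,
  fixes any field that vanishes on \<open>U\<close>; the Leibniz rule then makes its covariant derivative vanish.\<close>

lemma affine_connection_local:
  fixes U :: "(real^'n::finite) set"
  assumes D: "affine_connection_on U D" and U: "open U" "x \<in> U"
    and sm: "smooth_on U X" "smooth_on U V" "smooth_on U W" and eq: "\<And>y. y \<in> U \<Longrightarrow> V y = W y"
  shows "D X V x = D X W x"
proof -
  define f :: "real^'n \<Rightarrow> real" where "f y = (if y \<in> U then 0 else 1)" for y
  define N where "N y = V y - W y" for y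
  have f: "smooth_on U f"
    using smooth_on_cong[OF U(1), of "\<lambda>_. 0" f] by (simp add: f_def)
  have N: "smooth_on U N"
    unfolding N_def by (intro smooth_on_diff U sm)
  have "vderiv X (\<lambda>_. 0) x = vderiv X f x"
    by (rule vderiv_cong[OF U(2,1)]) (auto simp: f_def)
  then have "dir_deriv X f x = 0" by (simp add: dir_deriv_eq_vderiv)
  moreover have "(\<lambda>y. f y *\<^sub>R N y) = N"
    using eq by (auto simp: f_def N_def)
  moreover have "D X (\<lambda>y. f y *\<^sub>R N y) x = f x *\<^sub>R D X N x + dir_deriv X f x *\<^sub>R N x"
    using D U f N sm unfolding affine_connection_on_def by blast
  ultimately have "D X N x = 0" using U by (simp add: f_def)
  moreover have "D X (\<lambda>y. W y + N y) x = D X W x + D X N x"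
    using D U N sm unfolding affine_connection_on_def by blast
  ultimately show ?thesis by (simp add: N_def)
qed

text \<open>The difference of the two connections, paired with a third field by \<open>g\<close>, is
  symmetric in the first two fields (no torsion) and antisymmetric in the last two (compatibility),
  hence zero. Taking for the third field the constant one with the value of the difference at
  \<open>x\<close> turns this into \<open>g x v v = 0\<close>.\<close>

lemma levi_civita_unique:
  fixes U :: "(real^'n::finite) set"
  assumes g: "riemannian_metric_on U g" and D: "is_levi_civita_on U g D" "is_levi_civita_on U g D'"
    and sm: "smooth_on U X" "smooth_on U Y" and x: "x \<in> U"
  shows "D X Y x = D' X Y x"
proof -
  define T where "T A B C = g x (D A B x - D' A B x) (C x)" for A B C
  have bil: "bilinear (g x)" and sym: "g x u v = g x v u" for u v
    using g x by (auto simp: riemannian_metric_on_def)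
  have T1: "T A B C = T B A C" if "smooth_on U A" "smooth_on U B" for A B C
  proof -
    have "D A B x - D B A x = D' A B x - D' B A x"
      using D that x unfolding is_levi_civita_on_def by auto
    then have "D A B x - D' A B x = D B A x - D' B A x"
      by (simp add: algebra_simps)
    then show ?thesis by (simp add: T_def)
  qed
  have T2: "T A B C = - T A C B" if "smooth_on U A" "smooth_on U B" "smooth_on U C" for A B C
  proof -
    have "dir_deriv A (\<lambda>y. g y (B y) (C y)) x = g x (L A B x) (C x) + g x (L A C x) (B x)"
      if "is_levi_civita_on U g L" for L
      using that \<open>smooth_on U A\<close> \<open>smooth_on U B\<close> \<open>smooth_on U C\<close> x sym[of "B x" "L A C x"]
      unfolding is_levi_civita_on_def by simp
    from this[OF D(1)] this[OF D(2)] show ?thesis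
      by (simp add: T_def bilinear_lsub[OF bil])
  qed
  define v where "v = D X Y x - D' X Y x"
  define Z where "Z = (\<lambda>y :: real^'n. v)"
  have Z: "smooth_on U Z" by (simp add: Z_def)
  \<comment> \<open>Six alternating uses of the two symmetries restore the order \<open>X\<close>,
    \<open>Y\<close>, \<open>Z\<close> with three changes of sign.\<close>
  have "T X Y Z = - T X Y Z"
    using T2[OF sm Z] T1[OF sm(1) Z] T2[OF Z sm] T1[OF Z sm(2)] T2[OF sm(2) Z sm(1)] T1[OF sm] by simp
  then have "g x v v = 0" by (simp add: T_def v_def Z_def)
  then have "v = 0" using g x unfolding riemannian_metric_on_def by fastforce
  then show ?thesis by (simp add: v_def)
qed

text \<open>The witness \<open>D\<close> guarantees that the chosen connection is Levi-Civita, and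
  uniqueness compares the two. In the iterated derivatives the inner fields agree on
  \<open>U\<close> only, so \<open>affine_connection_local\<close> is required there.\<close>

lemma ricci_eq:
  assumes U: "open U" "x \<in> U" and g: "riemannian_metric_on U g" and E: "\<And>k. smooth_on U (E k)"
    and D: "is_levi_civita_on U g D" and sm: "smooth_on U Y" "smooth_on U Z"
  shows "ricci U g E Y Z x = (\<Sum>k\<in>UNIV. g x (curvature D (E k) Y Z x) (E k x))"
proof -
  define L where "L = levi_civita U g"
  have L: "is_levi_civita_on U g L"
    unfolding L_def levi_civita_def by (rule someI[of "is_levi_civita_on U g", OF D])
  have aff: "affine_connection_on U L" "affine_connection_on U D"
    using L D by (auto simp: is_levi_civita_on_def)
  have smL: "smooth_on U (L A B)" and smD: "smooth_on U (D A B)" if "smooth_on U A" "smooth_on U B" for A B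
    using aff that by (auto simp: affine_connection_on_def)
  note uniq = levi_civita_unique[OF g L D]
  have "L A (L B C) x = D A (D B C) x" if "smooth_on U A" "smooth_on U B" "smooth_on U C" for A B C
    using affine_connection_local[OF aff(2) U that(1) smL[OF that(2,3)] smD[OF that(2,3)] uniq[OF that(2,3)]]
      uniq[OF that(1) smL[OF that(2,3)] U(2)] by simp
  then have "curvature L (E k) Y Z x = curvature D (E k) Y Z x" for k
    unfolding curvature_def using E sm U uniq smooth_on_lie_bracket[OF U(1) E sm(1)] by simp
  then show ?thesis by (simp add: ricci_def L_def)
qed

section \<open>Torsion, compatibility and curvature in terms of Christoffel symbols\<close>

definition coord_conn :: "(real^'n \<Rightarrow> real^'n \<Rightarrow> real^'n \<Rightarrow> real^'n) \<Rightarrow> 'n::finite conn" where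
  "coord_conn \<Gamma> X Y x = vderiv X Y x + \<Gamma> x (X x) (Y x)"

context
  fixes U :: "(real^'n::finite) set" and \<Gamma> :: "real^'n \<Rightarrow> real^'n \<Rightarrow> real^'n \<Rightarrow> real^'n"
  assumes U: "open U" and \<Gamma>: "smooth_bilinear_on U \<Gamma>"
begin

private lemma bil: "x \<in> U \<Longrightarrow> bilinear (\<Gamma> x)"
  using \<Gamma> by (simp add: smooth_bilinear_on_def)

lemma smooth_on_coord_conn: "smooth_on U X \<Longrightarrow> smooth_on U Y \<Longrightarrow> smooth_on U (coord_conn \<Gamma> X Y)"
  unfolding coord_conn_def[abs_def]
  by (rule smooth_on_add[OF U smooth_on_vderiv[OF U] smooth_on_bilinear_field[OF U \<Gamma>]])

lemma affine_connection_coord_conn: "affine_connection_on U (coord_conn \<Gamma>)"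
  unfolding affine_connection_on_def
  by (auto simp: smooth_on_coord_conn)
    (auto simp: coord_conn_def dir_deriv_eq_vderiv vderiv_field_add vderiv_field_scaleR vderiv_add
      vderiv_scaleR bilinear_ladd[OF bil] bilinear_radd[OF bil] bilinear_lmul[OF bil] bilinear_rmul[OF bil]
      algebra_simps)

text \<open>After \<open>vderiv_bilinear\<close> has split off the derivatives of the fields,
  compatibility only involves their values at \<open>x\<close>, so it suffices to test it on
  constant vectors. The torsion reduces to the antisymmetric part of the Christoffel
  symbols.\<close>

lemma levi_civita_coord_conn:
  assumes g: "smooth_bilinear_on U g"
    and sym: "\<And>x u v. x \<in> U \<Longrightarrow> \<Gamma> x u v = \<Gamma> x v u"
    and compat: "\<And>x w u v. x \<in> U \<Longrightarrow>
      vderiv (\<lambda>_. w) (\<lambda>y. g y u v) x = g x (\<Gamma> x w u) v + g x u (\<Gamma> x w v)"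
  shows "is_levi_civita_on U g (coord_conn \<Gamma>)"
proof -
  have bg: "bilinear (g x)" if "x \<in> U" for x
    using g that by (simp add: smooth_bilinear_on_def)
  have "vderiv X (\<lambda>y. g y (Y y) (Z y)) x
      = g x (coord_conn \<Gamma> X Y x) (Z x) + g x (Y x) (coord_conn \<Gamma> X Z x)"
    if "smooth_on U X" "smooth_on U Y" "smooth_on U Z" "x \<in> U" for X Y Z x
  proof -
    have "vderiv X (\<lambda>y. g y (Y x) (Z x)) x = g x (\<Gamma> x (X x) (Y x)) (Z x) + g x (Y x) (\<Gamma> x (X x) (Z x))"
      using compat[OF that(4), of "X x" "Y x" "Z x"] by (simp add: vderiv_def)
    then show ?thesis
      unfolding vderiv_bilinear[OF U g that(2,3,4)]
      by (simp add: coord_conn_def bilinear_ladd[OF bg[OF that(4)]] bilinear_radd[OF bg[OF that(4)]])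
  qed
  moreover have "coord_conn \<Gamma> X Y x - coord_conn \<Gamma> Y X x = lie_bracket X Y x"
    if "smooth_on U X" "smooth_on U Y" "x \<in> U" for X Y x
    using sym[OF that(3)] by (simp add: coord_conn_def lie_bracket_eq_vderiv[OF that(3,1,2)])
  ultimately show ?thesis
    unfolding is_levi_civita_on_def dir_deriv_eq_vderiv
    using affine_connection_coord_conn by blast
qed

text \<open>Second derivatives of \<open>Z\<close> cancel by \<open>vderiv_commutator\<close>,
  derivatives of \<open>X\<close> and \<open>Y\<close> cancel against the bracket term, and first
  derivatives of \<open>Z\<close> paired with \<open>X\<close> or \<open>Y\<close> cancel by
  antisymmetry. What is left is the classical coordinate formula with all fields frozen at
  \<open>x\<close>.\<close>

lemma curvature_coord_conn:
  assumes x: "x \<in> U" and sm: "smooth_on U X" "smooth_on U Y" "smooth_on U Z"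
  shows "curvature (coord_conn \<Gamma>) X Y Z x
    = vderiv X (\<lambda>y. \<Gamma> y (Y x) (Z x)) x - vderiv Y (\<lambda>y. \<Gamma> y (X x) (Z x)) x
      + \<Gamma> x (X x) (\<Gamma> x (Y x) (Z x)) - \<Gamma> x (Y x) (\<Gamma> x (X x) (Z x))"
proof -
  have "coord_conn \<Gamma> A (coord_conn \<Gamma> B Z) x = vderiv A (vderiv B Z) x
      + (vderiv A (\<lambda>y. \<Gamma> y (B x) (Z x)) x + \<Gamma> x (vderiv A B x) (Z x) + \<Gamma> x (B x) (vderiv A Z x))
      + \<Gamma> x (A x) (vderiv B Z x) + \<Gamma> x (A x) (\<Gamma> x (B x) (Z x))"
    if "smooth_on U A" "smooth_on U B" for A B
  proof -
    have "vderiv A (coord_conn \<Gamma> B Z) x = vderiv A (vderiv B Z) x + vderiv A (\<lambda>y. \<Gamma> y (B y) (Z y)) x"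
      unfolding coord_conn_def[abs_def]
      by (rule vderiv_add[OF x smooth_on_vderiv[OF U that(2) sm(3)] smooth_on_bilinear_field[OF U \<Gamma> that(2) sm(3)]])
    then show ?thesis
      unfolding coord_conn_def[of \<Gamma> A] vderiv_bilinear[OF U \<Gamma> that(2) sm(3) x]
      by (simp add: coord_conn_def bilinear_radd[OF bil[OF x]])
  qed
  then have "curvature (coord_conn \<Gamma>) X Y Z x = vderiv X (vderiv Y Z) x - vderiv Y (vderiv X Z) x
      - vderiv (lie_bracket X Y) Z x + \<Gamma> x (vderiv X Y x) (Z x) - \<Gamma> x (vderiv Y X x) (Z x)
      - \<Gamma> x (lie_bracket X Y x) (Z x)
      + (vderiv X (\<lambda>y. \<Gamma> y (Y x) (Z x)) x - vderiv Y (\<lambda>y. \<Gamma> y (X x) (Z x)) x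
      + \<Gamma> x (X x) (\<Gamma> x (Y x) (Z x)) - \<Gamma> x (Y x) (\<Gamma> x (X x) (Z x)))"
    using sm by (simp add: curvature_def coord_conn_def[of \<Gamma> "lie_bracket X Y"] algebra_simps)
  then show ?thesis
    by (simp add: vderiv_commutator[OF U x sm] lie_bracket_eq_vderiv[OF x sm(1,2)] bilinear_lsub[OF bil[OF x]])
qed

end

section \<open>The metric on the box\<close>

lemma open_box3:
  assumes "open I1" "open I2" "open I3"
  shows "open (box3 I1 I2 I3)"
proof -
  have "box3 I1 I2 I3 = (\<lambda>x. x $ 1) -` I1 \<inter> (\<lambda>x. x $ 2) -` I2 \<inter> (\<lambda>x. x $ 3) -` I3"
    by (auto simp: box3_def)
  then show ?thesis
    using assms by (simp add: open_Int open_vimage_vec_nth)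
qed

text \<open>Only \<open>F\<close> is known to be smooth. Near \<open>x $ i\<close> the function
  \<open>h\<close> is the restriction of \<open>F\<close> to a coordinate line, so it inherits
  differentiability, and the chain rule leads back to \<open>F\<close>.\<close>

lemma has_derivative_coordinate_function:
  fixes U :: "(real^'n) set" and F :: "real^'n \<Rightarrow> real"
  assumes U: "open U" "x \<in> U" and F: "smooth_on U F" "\<And>y. y \<in> U \<Longrightarrow> F y = h (y $ i)"
  shows "(F has_derivative (\<lambda>v. v $ i * deriv h (x $ i))) (at x)"
proof -
  \<comment> \<open>The line through \<open>x\<close> along axis \<open>i\<close>, parametrised by
    its own \<open>i\<close>-th coordinate so that \<open>F (c t)\<close> equals \<open>h t\<close>
    whenever \<open>c t\<close> lies in \<open>U\<close>.\<close>
  define c where "c t = x + (t - x $ i) *\<^sub>R axis i 1" for t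
  let ?D = "frechet_derivative F (at x)"
  have D: "(F has_derivative ?D) (at x)"
    by (rule smooth_on_has_derivative[OF F(1) U(2)])
  have c0: "c (x $ i) = x" and ci: "c t $ i = t" for t
    by (simp_all add: c_def axis_def)
  have "((\<lambda>t. F (c t)) has_derivative (\<lambda>r. ?D (r *\<^sub>R axis i 1))) (at (x $ i))"
  proof (rule has_derivative_compose[where g=F and f=c])
    show "(c has_derivative (\<lambda>r. r *\<^sub>R axis i 1)) (at (x $ i))"
      unfolding c_def by (auto intro!: derivative_eq_intros)
  qed (use c0 D in simp)
  moreover have "open (c -` U)"
    unfolding c_def by (intro open_vimage U continuous_intros)
  ultimately have "(h has_derivative (\<lambda>r. ?D (r *\<^sub>R axis i 1))) (at (x $ i))"
    by (rule has_derivative_transform_within_open) (use U c0 F(2) ci in auto)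
  then have "(h has_real_derivative ?D (axis i 1)) (at (x $ i))"
    using linear_scale[OF has_derivative_linear[OF D]]
    by (simp add: has_field_derivative_def mult_commute_abs)
  then have "(h has_real_derivative deriv h (x $ i)) (at (x $ i))"
    by (metis DERIV_imp_deriv)
  then have h: "(h has_derivative (\<lambda>r. r * deriv h (x $ i))) (at (x $ i))"
    by (simp add: has_field_derivative_def mult_commute_abs)
  have "((\<lambda>y. h (y $ i)) has_derivative (\<lambda>v. v $ i * deriv h (x $ i))) (at x)"
    by (rule has_derivative_compose[where f="\<lambda>y. y $ i" and g=h,
          OF bounded_linear.has_derivative[OF bounded_linear_vec_nth has_derivative_ident] h])
  then show ?thesis
    by (rule has_derivative_transform_within_open[OF _ U]) (simp add: F(2))
qed

lemma smooth_on_deriv_coordinate_function: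
  fixes U :: "(real^'n) set" and F :: "real^'n \<Rightarrow> real"
  assumes U: "open U" and F: "smooth_on U F" "\<And>y. y \<in> U \<Longrightarrow> F y = h (y $ i)"
  shows "smooth_on U (\<lambda>y. deriv h (y $ i))"
proof -
  have "deriv h (y $ i) = frechet_derivative F (at y) (axis i 1)" if "y \<in> U" for y
    using frechet_derivative_eqI[OF has_derivative_coordinate_function[OF U that F]] by (simp add: axis_def)
  then show ?thesis
    by (subst smooth_on_cong[OF U]) (auto intro: smooth_on_frechet_derivative F)
qed

text \<open>The usual formula for a metric with diagonal entries \<open>1/h1^2\<close>,
  \<open>1/h2^2\<close>, \<open>1\<close>, of which the first depends on the second coordinate and
  the second on the first: the 12-entries of the two components are \<open>-a\<close> and
  \<open>-b\<close>, the 22-entry of the first is \<open>b * r\<close>, the 11-entry of the second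
  is \<open>a * s\<close>, and all others vanish.\<close>

definition christoffel_tilde ::
  "(real \<Rightarrow> real) \<Rightarrow> (real \<Rightarrow> real) \<Rightarrow> real^3 \<Rightarrow> real^3 \<Rightarrow> real^3 \<Rightarrow> real^3" where
  "christoffel_tilde h1 h2 x u v =
    (let a = deriv h1 (x $ 2) / h1 (x $ 2); b = deriv h2 (x $ 1) / h2 (x $ 1);
         r = (h1 (x $ 2))\<^sup>2 / (h2 (x $ 1))\<^sup>2; s = (h2 (x $ 1))\<^sup>2 / (h1 (x $ 2))\<^sup>2;
         m = u $ 1 * v $ 2 + u $ 2 * v $ 1
     in vector [b * r * (u $ 2 * v $ 2) - a * m, a * s * (u $ 1 * v $ 1) - b * m, 0])"

locale coordinate_metric =
  fixes I :: "(real^3) set" and f1 f2 :: "real^3 \<Rightarrow> real" and h1 h2 :: "real \<Rightarrow> real"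
  assumes I: "open I"
    and smooth: "smooth_on I f1" "smooth_on I f2"
    and nonzero: "\<And>x. x \<in> I \<Longrightarrow> f1 x \<noteq> 0" "\<And>x. x \<in> I \<Longrightarrow> f2 x \<noteq> 0"
    and dep: "\<And>x. x \<in> I \<Longrightarrow> f1 x = h1 (x $ 2)" "\<And>x. x \<in> I \<Longrightarrow> f2 x = h2 (x $ 1)"
begin

abbreviation "g \<equiv> g_tilde f1 f2"
abbreviation "E \<equiv> frame_tilde f1 f2"
abbreviation "\<Gamma> \<equiv> christoffel_tilde h1 h2"

definition a where "a t = deriv h1 t / h1 t"
definition b where "b t = deriv h2 t / h2 t"

text \<open>Gauss curvature of an orthogonal metric with coordinate lengths \<open>1/h1\<close> and
  \<open>1/h2\<close>, namely \<open>- h1 h2 (h1 (1/h2)'' + h2 (1/h1)'')\<close>, rewritten by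
  \<open>h2 (1/h2)'' = b^2 - b'\<close> and the same for \<open>h1\<close> and
  \<open>a\<close>.\<close>

definition K where
  "K x = (h1 (x $ 2))\<^sup>2 * (deriv b (x $ 1) - (b (x $ 1))\<^sup>2) + (h2 (x $ 1))\<^sup>2 * (deriv a (x $ 2) - (a (x $ 2))\<^sup>2)"

lemma nonzero_h: "x \<in> I \<Longrightarrow> h1 (x $ 2) \<noteq> 0" "x \<in> I \<Longrightarrow> h2 (x $ 1) \<noteq> 0"
  using nonzero dep by auto

lemma smooth_h: "smooth_on I (\<lambda>x. h1 (x $ 2))" "smooth_on I (\<lambda>x. h2 (x $ 1))"
  using smooth smooth_on_cong[OF I dep(1)] smooth_on_cong[OF I dep(2)] by auto

lemma smooth_ab: "smooth_on I (\<lambda>x. a (x $ 2))" "smooth_on I (\<lambda>x. b (x $ 1))"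
  unfolding a_def b_def
  by (intro smooth_on_divide I smooth_h nonzero_h smooth_on_deriv_coordinate_function[OF I smooth(1) dep(1)]
      smooth_on_deriv_coordinate_function[OF I smooth(2) dep(2)]; assumption)+

text \<open>Writing the derivative of \<open>h1\<close> as \<open>a * h1\<close>, and likewise for
  \<open>h2\<close>, keeps later derivatives rational in \<open>h1\<close>, \<open>h2\<close>,
  \<open>a\<close>, \<open>b\<close> and the derivatives of \<open>a\<close> and \<open>b\<close>,
  so that they can be compared by field arithmetic.\<close>

lemma has_derivative_h:
  assumes x: "x \<in> I"
  shows "((\<lambda>x. h1 (x $ 2)) has_derivative (\<lambda>w. w $ 2 * (a (x $ 2) * h1 (x $ 2)))) (at x)"
    and "((\<lambda>x. h2 (x $ 1)) has_derivative (\<lambda>w. w $ 1 * (b (x $ 1) * h2 (x $ 1)))) (at x)"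
    and "((\<lambda>x. a (x $ 2)) has_derivative (\<lambda>w. w $ 2 * deriv a (x $ 2))) (at x)"
    and "((\<lambda>x. b (x $ 1)) has_derivative (\<lambda>w. w $ 1 * deriv b (x $ 1))) (at x)"
  using has_derivative_coordinate_function[OF I x smooth_h(1)] nonzero_h[OF x]
    has_derivative_coordinate_function[OF I x smooth_h(2)]
    has_derivative_coordinate_function[OF I x smooth_ab(1)]
    has_derivative_coordinate_function[OF I x smooth_ab(2)]
  by (simp_all add: a_def b_def)

lemma g_eq: "x \<in> I \<Longrightarrow> g x u v =
    1 / (h1 (x $ 2))\<^sup>2 * (u $ 1 * v $ 1) + 1 / (h2 (x $ 1))\<^sup>2 * (u $ 2 * v $ 2) + u $ 3 * v $ 3"
  by (simp add: g_tilde_def dep)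

lemma smooth_g: "smooth_on I (\<lambda>x. g x u v)"
  unfolding g_tilde_def
  by (intro smooth_on_add smooth_on_mult smooth_on_divide smooth_on_power smooth_on_const smooth I)
    (simp_all add: nonzero)

lemma bilinear_g: "bilinear (g x)"
  unfolding bilinear_def g_tilde_def by (auto intro!: linearI simp: algebra_simps add_divide_distrib)

lemma riemannian_metric_g: "riemannian_metric_on I g"
  unfolding riemannian_metric_on_def
proof (intro conjI ballI allI impI)
  fix x v :: "real^3" assume x: "x \<in> I" and "v \<noteq> 0"
  then have v: "v $ 1 \<noteq> 0 \<or> v $ 2 \<noteq> 0 \<or> v $ 3 \<noteq> 0"
    by (auto simp: vec_eq_iff forall_3)
  have "g x v v = (v $ 1 / f1 x)\<^sup>2 + (v $ 2 / f2 x)\<^sup>2 + (v $ 3)\<^sup>2"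
    by (simp add: g_tilde_def power2_eq_square)
  moreover have "(v $ 1 / f1 x)\<^sup>2 > 0 \<or> (v $ 2 / f2 x)\<^sup>2 > 0 \<or> (v $ 3)\<^sup>2 > 0"
    using v nonzero[OF x] by auto
  moreover have "(v $ 1 / f1 x)\<^sup>2 \<ge> 0" "(v $ 2 / f2 x)\<^sup>2 \<ge> 0" "(v $ 3)\<^sup>2 \<ge> 0"
    by simp_all
  ultimately show "g x v v > 0" by linarith
qed (simp_all add: bilinear_g smooth_g, simp add: g_tilde_def mult.commute)

lemma smooth_E: "smooth_on I (E k)"
proof -
  have "smooth_on I (\<lambda>x. E k x)"
    unfolding frame_tilde_def
    by (cases "k = 1"; cases "k = 2") (auto intro!: smooth_on_scaleR I smooth)
  then show ?thesis by simp
qed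

lemma orthonormal_frame_E: "orthonormal_frame_on I g E"
  unfolding orthonormal_frame_on_def forall_3
  by (auto simp: smooth_E g_tilde_def frame_tilde_def axis_def nonzero power2_eq_square)

lemma vderiv_g:
  assumes x: "x \<in> I"
  shows "vderiv X (\<lambda>y. g y u v) x =
    - 2 * a (x $ 2) * X x $ 2 / (h1 (x $ 2))\<^sup>2 * (u $ 1 * v $ 1)
    - 2 * b (x $ 1) * X x $ 1 / (h2 (x $ 1))\<^sup>2 * (u $ 2 * v $ 2)"
proof -
  have "((\<lambda>x. 1 / (h1 (x $ 2))\<^sup>2 * (u $ 1 * v $ 1) + 1 / (h2 (x $ 1))\<^sup>2 * (u $ 2 * v $ 2) + u $ 3 * v $ 3)
    has_derivative (\<lambda>w. - 2 * a (x $ 2) * w $ 2 / (h1 (x $ 2))\<^sup>2 * (u $ 1 * v $ 1)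
    - 2 * b (x $ 1) * w $ 1 / (h2 (x $ 1))\<^sup>2 * (u $ 2 * v $ 2))) (at x)"
    by (rule derivative_eq_intros has_derivative_h[OF x] refl | simp add: nonzero_h[OF x])+
      (simp add: fun_eq_iff nonzero_h[OF x] field_simps power2_eq_square)
  then have "((\<lambda>y. g y u v) has_derivative (\<lambda>w. - 2 * a (x $ 2) * w $ 2 / (h1 (x $ 2))\<^sup>2 * (u $ 1 * v $ 1)
    - 2 * b (x $ 1) * w $ 1 / (h2 (x $ 1))\<^sup>2 * (u $ 2 * v $ 2))) (at x)"
    by (rule has_derivative_transform_within_open[OF _ I x]) (simp add: g_eq)
  then show ?thesis by (rule vderiv_eqI)
qed

lemma christoffel_nth:
  "\<Gamma> x u v $ 1 = b (x $ 1) * ((h1 (x $ 2))\<^sup>2 / (h2 (x $ 1))\<^sup>2) * (u $ 2 * v $ 2)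
    - a (x $ 2) * (u $ 1 * v $ 2 + u $ 2 * v $ 1)"
  "\<Gamma> x u v $ 2 = a (x $ 2) * ((h2 (x $ 1))\<^sup>2 / (h1 (x $ 2))\<^sup>2) * (u $ 1 * v $ 1)
    - b (x $ 1) * (u $ 1 * v $ 2 + u $ 2 * v $ 1)"
  "\<Gamma> x u v $ 3 = 0"
  by (simp_all add: christoffel_tilde_def Let_def vector_3 a_def b_def)

lemma smooth_bilinear_christoffel: "smooth_bilinear_on I \<Gamma>"
  unfolding smooth_bilinear_on_def
proof (intro conjI ballI allI)
  fix x show "bilinear (\<Gamma> x)"
    unfolding bilinear_def
    by (auto intro!: linearI simp: vec_eq_iff forall_3 christoffel_nth algebra_simps add_divide_distrib)
next
  fix u v
  have "\<forall>i. smooth_on I (\<lambda>x. \<Gamma> x u v $ i)"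
    unfolding forall_3 christoffel_nth
    by (auto intro!: smooth_on_diff smooth_on_mult smooth_on_divide smooth_on_power smooth_h smooth_ab I simp: nonzero_h)
  then show "smooth_on I (\<lambda>x. \<Gamma> x u v)"
    by (intro smooth_on_vecI I) simp
qed

lemma vderiv_christoffel:
  assumes x: "x \<in> I"
  shows "vderiv X (\<lambda>y. \<Gamma> y u v) x $ 1 =
      (deriv b (x $ 1) * X x $ 1 + 2 * b (x $ 1) * (a (x $ 2) * X x $ 2 - b (x $ 1) * X x $ 1))
        * ((h1 (x $ 2))\<^sup>2 / (h2 (x $ 1))\<^sup>2) * (u $ 2 * v $ 2)
      - deriv a (x $ 2) * X x $ 2 * (u $ 1 * v $ 2 + u $ 2 * v $ 1)" (is "_ = ?d1 (X x)")
    and "vderiv X (\<lambda>y. \<Gamma> y u v) x $ 2 =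
      (deriv a (x $ 2) * X x $ 2 + 2 * a (x $ 2) * (b (x $ 1) * X x $ 1 - a (x $ 2) * X x $ 2))
        * ((h2 (x $ 1))\<^sup>2 / (h1 (x $ 2))\<^sup>2) * (u $ 1 * v $ 1)
      - deriv b (x $ 1) * X x $ 1 * (u $ 1 * v $ 2 + u $ 2 * v $ 1)" (is "_ = ?d2 (X x)")
    and "vderiv X (\<lambda>y. \<Gamma> y u v) x $ 3 = 0"
proof -
  have s: "smooth_on I (\<lambda>x. \<Gamma> x u v)"
    using smooth_bilinear_christoffel by (simp add: smooth_bilinear_on_def)
  have "((\<lambda>y. \<Gamma> y u v $ 1) has_derivative ?d1) (at x)"
    unfolding christoffel_nth
    by (rule derivative_eq_intros has_derivative_h[OF x] refl | simp add: nonzero_h[OF x])+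
      (simp add: fun_eq_iff nonzero_h[OF x] field_simps power2_eq_square)
  then show "vderiv X (\<lambda>y. \<Gamma> y u v) x $ 1 = ?d1 (X x)"
    unfolding vderiv_nth[OF x s, symmetric] by (rule vderiv_eqI)
  have "((\<lambda>y. \<Gamma> y u v $ 2) has_derivative ?d2) (at x)"
    unfolding christoffel_nth
    by (rule derivative_eq_intros has_derivative_h[OF x] refl | simp add: nonzero_h[OF x])+
      (simp add: fun_eq_iff nonzero_h[OF x] field_simps power2_eq_square)
  then show "vderiv X (\<lambda>y. \<Gamma> y u v) x $ 2 = ?d2 (X x)"
    unfolding vderiv_nth[OF x s, symmetric] by (rule vderiv_eqI)
  show "vderiv X (\<lambda>y. \<Gamma> y u v) x $ 3 = 0"
    unfolding vderiv_nth[OF x s, symmetric] christoffel_nth by simp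
qed

section \<open>Connection, Ricci tensor and soliton equation of the metric\<close>

lemma levi_civita_christoffel: "is_levi_civita_on I g (coord_conn \<Gamma>)"
proof (rule levi_civita_coord_conn[OF I smooth_bilinear_christoffel
      riemannian_metric_on_smooth_bilinear[OF riemannian_metric_g]])
  fix x u v w assume x: "x \<in> I"
  show "\<Gamma> x u v = \<Gamma> x v u"
    by (simp add: vec_eq_iff forall_3 christoffel_nth algebra_simps)
  show "vderiv (\<lambda>_. w) (\<lambda>y. g y u v) x = g x (\<Gamma> x w u) v + g x u (\<Gamma> x w v)"
    unfolding vderiv_g[OF x] g_eq[OF x] christoffel_nth
    by (simp add: nonzero_h[OF x] field_simps power2_eq_square)
qed

text \<open>In the trace, \<open>E 1\<close> contributes \<open>K\<close> times the
  second-coordinate part of the metric and \<open>E 2\<close> contributes \<open>K\<close> times the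
  first-coordinate part. \<open>E 3\<close> contributes nothing, since the curvature has no third
  component. With the curvature formula inserted, this is an identity of rational
  expressions.\<close>

lemma ricci_g:
  assumes x: "x \<in> I" and sm: "smooth_on I Y" "smooth_on I Z"
  shows "ricci I g E Y Z x = K x * (g x (Y x) (Z x) - Y x $ 3 * Z x $ 3)"
  unfolding ricci_eq[OF I x riemannian_metric_g smooth_E levi_civita_christoffel sm]
    curvature_coord_conn[OF I smooth_bilinear_christoffel x smooth_E sm] sum_3
    g_eq[OF x] vector_add_component vector_minus_component vderiv_christoffel[OF x] christoffel_nth K_def
  by (simp add: frame_tilde_def axis_def dep[OF x] nonzero_h[OF x] field_simps power2_eq_square)

text \<open>The field is constant, so the two brackets are plain derivatives of \<open>Y\<close> and
  \<open>Z\<close> and cancel the matching Leibniz terms. There remains the derivative of the metric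
  coefficients along the third axis, and these vary only with the first two coordinates.\<close>

lemma lie_deriv_g:
  assumes x: "x \<in> I" and sm: "smooth_on I Y" "smooth_on I Z"
  shows "lie_deriv2 (\<lambda>x. axis 3 1) g Y Z x = 0"
proof -
  have "lie_bracket (\<lambda>x. axis 3 1) W x = vderiv (\<lambda>x. axis 3 1) W x" if "smooth_on I W" for W :: "3 vfield"
    using lie_bracket_eq_vderiv[OF x smooth_on_const that] by simp
  then show ?thesis
    unfolding lie_deriv2_def dir_deriv_eq_vderiv
      vderiv_bilinear[OF I riemannian_metric_on_smooth_bilinear[OF riemannian_metric_g] sm x] vderiv_g[OF x]
    using sm by (simp add: axis_def)
qed

lemma soliton_iff:
  assumes "smooth_on I l" "smooth_on I m" "\<exists>x\<in>I. m x \<noteq> 0"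
  shows "almost_eta_ricci_soliton_on I g E (\<lambda>x. axis 3 1) (\<lambda>x v. v $ 3) l m
    \<longleftrightarrow> (\<forall>x\<in>I. l x = - K x) \<and> (\<forall>x\<in>I. m x = K x)"
proof -
  have eq: "(1/2) * lie_deriv2 (\<lambda>x. axis 3 1) g Y Z x + ricci I g E Y Z x
      + l x * g x (Y x) (Z x) + m x * (Y x $ 3 * Z x $ 3)
      = (K x + l x) * g x (Y x) (Z x) + (m x - K x) * (Y x $ 3 * Z x $ 3)"
    if "x \<in> I" "smooth_on I Y" "smooth_on I Z" for x Y Z
    unfolding lie_deriv_g[OF that] ricci_g[OF that] by (simp add: algebra_simps)
  have "smooth_form1_on I (\<lambda>x v. v $ 3)"
    by (auto simp: smooth_form1_on_def intro!: linearI)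
  then have "almost_eta_ricci_soliton_on I g E (\<lambda>x. axis 3 1) (\<lambda>x v. v $ 3) l m \<longleftrightarrow>
      (\<forall>Y Z. smooth_on I Y \<longrightarrow> smooth_on I Z \<longrightarrow>
        (\<forall>x\<in>I. (K x + l x) * g x (Y x) (Z x) + (m x - K x) * (Y x $ 3 * Z x $ 3) = 0))"
    unfolding almost_eta_ricci_soliton_on_def
    using assms riemannian_metric_g orthonormal_frame_E eq by auto
  also have "\<dots> \<longleftrightarrow> (\<forall>x\<in>I. l x = - K x) \<and> (\<forall>x\<in>I. m x = K x)"
  proof
    assume *: "\<forall>Y Z. smooth_on I Y \<longrightarrow> smooth_on I Z \<longrightarrow>
        (\<forall>x\<in>I. (K x + l x) * g x (Y x) (Z x) + (m x - K x) * (Y x $ 3 * Z x $ 3) = 0)"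
    have "l x = - K x \<and> m x = K x" if x: "x \<in> I" for x
    proof -
      have **: "(K x + l x) * g x v v + (m x - K x) * (v $ 3 * v $ 3) = 0" for v
        using *[rule_format, of "\<lambda>_. v" "\<lambda>_. v" x] x by simp
      \<comment> \<open>On the first axis the form vanishes while \<open>g\<close> does not, which
        gives \<open>l x = - K x\<close>; on the third axis both are \<open>1\<close>, so the other
        coefficient vanishes as well.\<close>
      show ?thesis
        using **[of "axis 1 1"] **[of "axis 3 1"] nonzero[OF x] by (simp add: g_tilde_def axis_def)
    qed
    then show "(\<forall>x\<in>I. l x = - K x) \<and> (\<forall>x\<in>I. m x = K x)" by blast
  qed auto
  finally show ?thesis .
qed

end

theorem theorem3p30:
  fixes I1 I2 I3 :: "real set"
    and f1 f2 lam \<mu> :: "real^3 \<Rightarrow> real"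
    and h1 h2 :: "real \<Rightarrow> real"
    and I :: "(real^3) set"
  assumes "I = box3 I1 I2 I3"
    and "open I1" "is_interval I1" "open I2" "is_interval I2" "open I3" "is_interval I3"
    and "smooth_on I f1" "smooth_on I f2"
    and "\<forall>x\<in>I. f1 x \<noteq> 0" "\<forall>x\<in>I. f2 x \<noteq> 0"
    and "smooth_on I lam" "smooth_on I \<mu>" "\<exists>x\<in>I. \<mu> x \<noteq> 0"
    and f1_dep: "\<forall>x\<in>I. f1 x = h1 (x $ 2)"
    and f2_dep: "\<forall>x\<in>I. f2 x = h2 (x $ 1)"
  shows "almost_eta_ricci_soliton_on I (g_tilde f1 f2) (frame_tilde f1 f2)
           (\<lambda>x. axis 3 1) (\<lambda>x v. v $ 3) lam \<mu> \<longleftrightarrow>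
         (\<forall>x\<in>I. lam x =
             - ((h1 (x $ 2))\<^sup>2 * (deriv (\<lambda>t. deriv h2 t / h2 t) (x $ 1) - (deriv h2 (x $ 1) / h2 (x $ 1))\<^sup>2))
             - ((h2 (x $ 1))\<^sup>2 * (deriv (\<lambda>t. deriv h1 t / h1 t) (x $ 2) - (deriv h1 (x $ 2) / h1 (x $ 2))\<^sup>2))) \<and>
         (\<forall>x\<in>I. \<mu> x =
             (h1 (x $ 2))\<^sup>2 * (deriv (\<lambda>t. deriv h2 t / h2 t) (x $ 1) - (deriv h2 (x $ 1) / h2 (x $ 1))\<^sup>2)
             + (h2 (x $ 1))\<^sup>2 * (deriv (\<lambda>t. deriv h1 t / h1 t) (x $ 2) - (deriv h1 (x $ 2) / h1 (x $ 2))\<^sup>2))"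
proof -
  interpret coordinate_metric I f1 f2 h1 h2
    by unfold_locales (use assms open_box3 in auto)
  have K: "- K x = - ((h1 (x $ 2))\<^sup>2 * (deriv b (x $ 1) - (b (x $ 1))\<^sup>2))
      - (h2 (x $ 1))\<^sup>2 * (deriv a (x $ 2) - (a (x $ 2))\<^sup>2)" for x
    by (simp add: K_def)
  show ?thesis
    using soliton_iff[OF assms(12-14)] unfolding K unfolding K_def a_def[abs_def] b_def[abs_def] .
qed

end
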